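(* Let $\mathscr{B}\subset\mathbb{N}$. If $\mathscr{B}$ has light tails and contains an infinite, pairwise coprime subset then $X_\eta=\widetilde{X}_\eta$.
   Context: $\mathbb{N}=\{1,2,\dots\}$. For $\mathscr{B}\subset\mathbb{N}$ let $\mathcal{F}_{\mathscr{B}}:=\mathbb{Z}\setminus\bigcup_{b\in\mathscr{B}}b\mathbb{Z}$, and let $\eta\in\{0,1\}^{\mathbb{Z}}$ be the characteristic function of $\mathcal{F}_{\mathscr{B}}$. $S$ is the left shift on $\{0,1\}^{\mathbb{Z}}$ (product topology), and $X_\eta$ is the closure of $\{S^m\eta : m\in\mathbb{Z}\}$. A subshift $X\subset\{0,1\}^{\mathbb{Z}}$ (closed, $S$-invariant set) is hereditary if $x\in X$ and $y\le x$ coordinatewise imply $y\in X$; $\widetilde{X}_\eta$ is the smallest hereditary subshift containing $X_\eta$. The upper density of $A\subset\mathbb{Z}$ is $\overline{d}(A)=\limsup_{N\to\infty}\frac1N|A\cap[1,N]|$. $\mathscr{B}$ has light tails if $\lim_{K\to\infty}\overline{d}\left(\bigcup_{b\in\mathscr{B},\,b>K}b\mathbb{Z}\right)=0$. *)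

theory Defs
  imports "HOL-Analysis.Analysis"
begin

text \<open>Points of $\{0,1\}^{\mathbb{Z}}$ are functions \<^typ>\<open>int \<Rightarrow> bool\<close>, with 0 as \<^term>\<open>False\<close> and
  1 as \<^term>\<open>True\<close>. The type classes supply the product of the discrete topologies (for
  \<^const>\<open>closed\<close> and \<^const>\<open>closure\<close>) and the coordinatewise order.\<close>

type_synonym config = "int \<Rightarrow> bool"

lemma open_bool: "open (A :: bool set)"
  by (rule open_discrete)

definition multiples :: "nat \<Rightarrow> int set" where
  "multiples b = range (\<lambda>k::int. int b * k)"

definition free_set :: "nat set \<Rightarrow> int set" where
  "free_set B = UNIV - (\<Union>b\<in>B. multiples b)"

definition eta :: "nat set \<Rightarrow> config" where
  "eta B = (\<lambda>n. n \<in> free_set B)"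

definition shift :: "config \<Rightarrow> config" where
  "shift x = (\<lambda>n. x (n + 1))"

definition shift_power :: "int \<Rightarrow> config \<Rightarrow> config" where
  "shift_power m = (if 0 \<le> m then shift ^^ nat m else inv shift ^^ nat (- m))"

definition X_eta :: "nat set \<Rightarrow> config set" where
  "X_eta B = closure (range (\<lambda>m. shift_power m (eta B)))"

definition subshift :: "config set \<Rightarrow> bool" where
  "subshift X \<longleftrightarrow> closed X \<and> shift ` X = X"

definition hereditary :: "config set \<Rightarrow> bool" where
  "hereditary X \<longleftrightarrow> (\<forall>x\<in>X. \<forall>y. y \<le> x \<longrightarrow> y \<in> X)"

definition X_tilde :: "nat set \<Rightarrow> config set" where
  "X_tilde B = \<Inter> {X. subshift X \<and> hereditary X \<and> X_eta B \<subseteq> X}"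

text \<open>The value at \<open>N = 0\<close> is irrelevant for the limit superior.\<close>

definition upper_density :: "int set \<Rightarrow> ereal" where
  "upper_density A = limsup (\<lambda>N::nat. ereal (real (card (A \<inter> {1..int N})) / real N))"

definition light_tails :: "nat set \<Rightarrow> bool" where
  "light_tails B \<longleftrightarrow>
     (\<lambda>K::nat. upper_density (\<Union>b\<in>{b \<in> B. b > K}. multiples b)) \<longlonglongrightarrow> 0"

lemma shift_inv: "inv shift = (\<lambda>x n. x (n - 1))"
  by (rule inv_unique_comp) (auto simp: shift_def fun_eq_iff)

lemma bij_shift: "bij shift"
  by (rule o_bij[where g = "\<lambda>x n. x (n - 1)"]) (auto simp: shift_def fun_eq_iff)

lemma shift_power_apply: "shift_power m x n = x (n + m)"
proof -
  have 1: "(shift ^^ k) x n = x (n + int k)" for k n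
    by (induction k arbitrary: n) (auto simp: shift_def algebra_simps)
  have 2: "(inv shift ^^ k) x n = x (n - int k)" for k n
    by (induction k arbitrary: n) (auto simp: shift_inv algebra_simps)
  show ?thesis by (simp add: shift_power_def 1 2)
qed

text \<open>The intersection defining \<^const>\<open>X_tilde\<close> is itself a hereditary subshift containing
  \<^const>\<open>X_eta\<close>, hence the smallest one.\<close>

lemma X_tilde_smallest:
  shows "subshift (X_tilde B)" "hereditary (X_tilde B)" "X_eta B \<subseteq> X_tilde B"
    and "subshift X \<Longrightarrow> hereditary X \<Longrightarrow> X_eta B \<subseteq> X \<Longrightarrow> X_tilde B \<subseteq> X"
proof -
  let ?F = "{X. subshift X \<and> hereditary X \<and> X_eta B \<subseteq> X}"
  have ne: "UNIV \<in> ?F"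
    using bij_is_surj[OF bij_shift] by (auto simp: subshift_def hereditary_def)
  have "shift ` \<Inter> ?F = (\<Inter>X\<in>?F. shift ` X)"
    using bij_image_INT[OF bij_shift, of "\<lambda>X. X" ?F] by simp
  also have "\<dots> = \<Inter> ?F"
    by (auto simp: subshift_def)
  finally show "subshift (X_tilde B)"
    unfolding X_tilde_def subshift_def by (auto simp: subshift_def intro!: closed_Inter)
  show "hereditary (X_tilde B)" "X_eta B \<subseteq> X_tilde B"
    unfolding X_tilde_def by (auto simp: hereditary_def)
  show "subshift X \<Longrightarrow> hereditary X \<Longrightarrow> X_eta B \<subseteq> X \<Longrightarrow> X_tilde B \<subseteq> X"
    unfolding X_tilde_def by blast
qed

end

theory Submission
  imports Defs "HOL-Number_Theory.Cong"
begin

text \<open>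
  It suffices that \<open>X_eta B\<close> is hereditary, since it is a subshift contained in \<open>X_tilde B\<close>. By the
  description of the closure through finite windows, this is a statement about integers: given \<open>m\<close>,
  a finite set \<open>I\<close> with all \<open>m + i\<close> (\<open>i \<in> I\<close>) \<open>B\<close>-free, and a finite set \<open>C\<close> disjoint from \<open>I\<close>,
  find \<open>x\<close> such that all \<open>x + i\<close> are \<open>B\<close>-free while no \<open>x + j\<close> (\<open>j \<in> C\<close>) is
  (\<open>exists_translate_with_pattern\<close>).

  The infinite coprime subset destroys the positions in \<open>C\<close>: for each \<open>j \<in> C\<close> pick \<open>a j \<in> B\<close>, pairwise
  coprime and coprime to a modulus \<open>L\<close>, and require that \<open>a j\<close> divides \<open>x + j\<close>. Together with
  \<open>x \<equiv> m\<close> modulo \<open>L\<close> this confines \<open>x\<close> to an arithmetic progression of modulus \<open>Q = L * \<Prod>a j\<close>, in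
  which an element with all \<open>x + i\<close> \<open>B\<close>-free has to be found. Light tails give this by a density
  count, but not directly: the tail of \<open>B\<close> has to be sparse relative to the progression, although \<open>Q\<close>
  is chosen after the tail.

  The way out is that \<open>L\<close> is divisible by \<open>y!\<close> and by the square of every \<open>n = m + i\<close>. Then \<open>x + i\<close>
  is \<open>n\<close> times a number coprime to \<open>L\<close>, so any \<open>b \<in> B\<close> dividing \<open>x + i\<close> factors as \<open>b = d * c\<close> with \<open>d\<close>
  among the finitely many divisors of \<open>n\<close> and \<open>c > y\<close> coprime to \<open>Q\<close> (\<open>new_divisor_split\<close>). Being
  divisible by some such \<open>c\<close> is independent of the progression, and the numbers divisible by some such
  \<open>c\<close> have density at most \<open>d\<close> times the density of the multiples of elements of \<open>B\<close> above \<open>y\<close>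
  (\<open>upper_density_cofactor_multiples_le\<close>). The sum of these bounds over \<open>i\<close> and \<open>d\<close> does not involve
  \<open>Q\<close> and is small if \<open>y\<close> was large. As independence needs finitely many \<open>c\<close>, the elements of \<open>B\<close>
  above a second threshold \<open>K\<close>, chosen after \<open>Q\<close>, are estimated separately.
\<close>

section \<open>Upper density of sets of integers\<close>

lemma upper_density_mono:
  assumes "A \<subseteq> A'"
  shows "upper_density A \<le> upper_density A'"
  unfolding upper_density_def
  using assms by (intro Limsup_mono always_eventually allI)
    (auto intro!: divide_right_mono card_mono)

text \<open>Bounds on an upper density are manipulated through this form, which turns the limit superior
  into linear estimates of counting functions.\<close>
lemma upper_density_le_iff:
  "upper_density A \<le> ereal r \<longleftrightarrow>
     (\<forall>e>0. eventually (\<lambda>N. real (card (A \<inter> {1..int N})) \<le> (r + e) * real N) sequentially)"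
    (is "_ \<longleftrightarrow> ?R")
proof
  assume *: "upper_density A \<le> ereal r"
  show ?R
  proof (intro allI impI)
    fix e :: real assume "e > 0"
    with * have "upper_density A < ereal (r + e)"
      by (simp add: le_less_trans)
    then have "eventually (\<lambda>N. ereal (real (card (A \<inter> {1..int N})) / real N) < ereal (r + e))
      sequentially"
      unfolding upper_density_def by (rule Limsup_lessD)
    then show "eventually (\<lambda>N. real (card (A \<inter> {1..int N})) \<le> (r + e) * real N) sequentially"
      using eventually_gt_at_top[of 0]
      by eventually_elim (auto simp: divide_simps split: if_splits)
  qed
next
  assume R: ?R
  have "upper_density A \<le> ereal r + ereal e" if "e > 0" for e
  proof -
    from R that have "eventually (\<lambda>N. real (card (A \<inter> {1..int N})) \<le> (r + e) * real N) sequentially"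
      by blast
    then have "eventually (\<lambda>N. ereal (real (card (A \<inter> {1..int N})) / real N) \<le> ereal (r + e))
      sequentially"
      using eventually_gt_at_top[of 0]
      by eventually_elim (auto simp: divide_simps)
    then show ?thesis
      unfolding upper_density_def plus_ereal.simps(1) by (rule Limsup_bounded)
  qed
  then show "upper_density A \<le> ereal r"
    by (rule ereal_le_epsilon2)
qed

lemma upper_density_le_of_linear_bound:
  assumes "\<And>N::nat. real (card (A \<inter> {1..int N})) \<le> r * real N + k"
  shows "upper_density A \<le> ereal r"
  unfolding upper_density_le_iff
proof (intro allI impI)
  fix e :: real assume e: "e > 0"
  have "eventually (\<lambda>N. real N \<ge> k / e) sequentially"
    using filterlim_real_sequentially unfolding filterlim_at_top by blast
  then show "eventually (\<lambda>N. real (card (A \<inter> {1..int N})) \<le> (r + e) * real N) sequentially"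
  proof eventually_elim
    case (elim N)
    then have "k \<le> e * real N" using e by (simp add: field_simps)
    with assms[of N] show ?case by (simp add: algebra_simps)
  qed
qed

lemma upper_density_Un_le:
  assumes "upper_density A \<le> ereal r" "upper_density A' \<le> ereal r'"
  shows "upper_density (A \<union> A') \<le> ereal (r + r')"
  unfolding upper_density_le_iff
proof (intro allI impI)
  fix e :: real assume "e > 0"
  then have "e / 2 > 0" by simp
  with assms have
    "eventually (\<lambda>N. real (card (A \<inter> {1..int N})) \<le> (r + e/2) * real N) sequentially"
    "eventually (\<lambda>N. real (card (A' \<inter> {1..int N})) \<le> (r' + e/2) * real N) sequentially"
    unfolding upper_density_le_iff by blast+
  then show "eventually (\<lambda>N. real (card ((A \<union> A') \<inter> {1..int N})) \<le> (r + r' + e) * real N) sequentially"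
  proof eventually_elim
    case (elim N)
    have "card ((A \<union> A') \<inter> {1..int N}) \<le> card (A \<inter> {1..int N}) + card (A' \<inter> {1..int N})"
      unfolding Int_Un_distrib2 by (rule card_Un_le)
    with elim show ?case by (simp add: algebra_simps)
  qed
qed

lemma upper_density_empty: "upper_density {} = 0"
  by (simp add: upper_density_def Limsup_const zero_ereal_def)

lemma upper_density_UN_le:
  assumes "finite I" "\<And>i. i \<in> I \<Longrightarrow> upper_density (A i) \<le> ereal (r i)"
  shows "upper_density (\<Union>i\<in>I. A i) \<le> ereal (\<Sum>i\<in>I. r i)"
  using assms
proof (induction I rule: finite_induct)
  case empty
  then show ?case by (simp add: upper_density_empty)
next
  case (insert i I)
  then show ?case using upper_density_Un_le[of "A i" "r i"] by simp
qed

lemma upper_density_UNIV: "upper_density UNIV = 1"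
proof -
  have "eventually (\<lambda>N. ereal (real N / real N) = 1) sequentially"
    using eventually_gt_at_top[of 0] by eventually_elim auto
  then have "limsup (\<lambda>N. ereal (real N / real N)) = limsup (\<lambda>N::nat. 1)"
    by (rule Limsup_eq)
  then show ?thesis
    by (simp add: upper_density_def Limsup_const)
qed

text \<open>The map \<open>t \<mapsto> q * t + s\<close> is injective and sends \<open>{1..N}\<close> into \<open>{1..q * N}\<close> up to at most
  \<open>2 * \<bar>s\<bar>\<close> boundary values, so passing to an arithmetic progression multiplies a density by at most
  its modulus. This factor is affordable in two situations: the progression is fixed before the
  set is made sparse, or \<open>q\<close> is a divisor of a fixed number.\<close>
lemma upper_density_affine_preimage_le:
  fixes q s :: int
  assumes q: "q > 0" and A: "upper_density A \<le> ereal r"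
  shows "upper_density {t. q * t + s \<in> A} \<le> ereal (real_of_int q * r)"
  unfolding upper_density_le_iff
proof (intro allI impI)
  fix e :: real assume e: "e > 0"
  let ?T = "{t. q * t + s \<in> A}"
  define e' where "e' = e / (2 * real_of_int q)"
  have e': "e' > 0" using e q by (simp add: e'_def)
  have lim: "filterlim (\<lambda>N. nat q * N) at_top sequentially"
    using q by (intro mult_nat_left_at_top) auto
  have "eventually (\<lambda>N. real (card (A \<inter> {1..int (nat q * N)})) \<le> (r + e') * real (nat q * N)) sequentially"
    using A e' filterlim_iff[THEN iffD1, OF lim] unfolding upper_density_le_iff by blast
  moreover have "eventually (\<lambda>N. real N \<ge> 2 * (2 * real_of_int \<bar>s\<bar>) / e) sequentially"
    using filterlim_real_sequentially unfolding filterlim_at_top by blast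
  ultimately show "eventually (\<lambda>N. real (card (?T \<inter> {1..int N})) \<le> (real_of_int q * r + e) * real N) sequentially"
  proof eventually_elim
    case (elim N)
    let ?f = "\<lambda>t. q * t + s" and ?E = "{1 - \<bar>s\<bar>..0} \<union> {q * int N + 1..q * int N + \<bar>s\<bar>}"
    have "?f ` (?T \<inter> {1..int N}) \<subseteq> (A \<inter> {1..q * int N}) \<union> ?E"
    proof
      fix z assume "z \<in> ?f ` (?T \<inter> {1..int N})"
      then obtain t where "t \<in> ?T \<inter> {1..int N}" "z = ?f t" by blast
      then have t: "z = q * t + s" "z \<in> A" "1 \<le> t" "t \<le> int N" by auto
      have "q * 1 \<le> q * t" "q * t \<le> q * int N"
        using t q by (intro mult_left_mono; simp)+
      then have "1 - \<bar>s\<bar> \<le> z" "z \<le> q * int N + \<bar>s\<bar>" using t q by linarith+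
      with t show "z \<in> (A \<inter> {1..q * int N}) \<union> ?E" by auto
    qed
    moreover have "inj_on ?f (?T \<inter> {1..int N})" using q by (auto simp: inj_on_def)
    ultimately have "card (?T \<inter> {1..int N}) \<le> card ((A \<inter> {1..q * int N}) \<union> ?E)"
      by (intro card_inj_on_le[of ?f]) auto
    also have "\<dots> \<le> card (A \<inter> {1..q * int N}) + card ?E" by (rule card_Un_le)
    also have "card ?E \<le> nat \<bar>s\<bar> + nat \<bar>s\<bar>"
      by (rule order_trans[OF card_Un_le]) auto
    finally have "real (card (?T \<inter> {1..int N})) \<le> real (card (A \<inter> {1..q * int N})) + 2 * real_of_int \<bar>s\<bar>"
      by linarith
    also have "real (card (A \<inter> {1..q * int N})) \<le> (r + e') * (real_of_int q * real N)"
      using elim(1) q by simp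
    also have "(r + e') * (real_of_int q * real N) = (real_of_int q * r + e / 2) * real N"
      using q by (simp add: e'_def field_simps)
    also have "2 * real_of_int \<bar>s\<bar> \<le> e / 2 * real N"
      using elim(2) e by (simp add: field_simps)
    finally show ?case by (simp add: algebra_simps)
  qed
qed

lemma periodic_add_mult:
  fixes R :: int
  assumes "\<And>x. x + R \<in> A \<longleftrightarrow> x \<in> A"
  shows "x + R * k \<in> A \<longleftrightarrow> x \<in> A"
proof (induction k rule: int_induct[where k = 0])
  case base
  then show ?case by simp
next
  case (step1 i)
  then show ?case using assms[of "x + R * i"] by (simp add: algebra_simps)
next
  case (step2 i)
  then show ?case using assms[of "x + R * (i - 1)"] by (simp add: algebra_simps)
qed

lemma card_periodic_initial:
  fixes R :: nat
  assumes "\<And>x. x + int R \<in> A \<longleftrightarrow> x \<in> A"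
  shows "card (A \<inter> {1..int (R * k)}) = k * card (A \<inter> {1..int R})"
proof (induction k)
  case 0
  then show ?case by simp
next
  case (Suc k)
  have split: "A \<inter> {1..int (R * Suc k)} =
      (A \<inter> {1..int (R * k)}) \<union> (\<lambda>x. x + int R * int k) ` (A \<inter> {1..int R})"
    (is "_ = _ \<union> ?S")
  proof -
    have "?S = A \<inter> {int (R * k) + 1..int (R * Suc k)}"
    proof (intro set_eqI iffI)
      fix x assume "x \<in> A \<inter> {int (R * k) + 1..int (R * Suc k)}"
      moreover from this have "x - int R * int k \<in> A"
        using periodic_add_mult[of "int R" A "x - int R * int k" "int k", OF assms] by simp
      ultimately show "x \<in> ?S"
        by (intro image_eqI[of _ _ "x - int R * int k"]) (auto simp: algebra_simps)
    qed (auto simp: periodic_add_mult[of "int R", OF assms] algebra_simps)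
    moreover have "{1..int (R * Suc k)} = {1..int (R * k)} \<union> {int (R * k) + 1..int (R * Suc k)}"
    proof -
      have "0 \<le> int (R * k)" "int (R * k) \<le> int (R * Suc k)" by simp_all
      then show ?thesis by (auto simp del: of_nat_mult)
    qed
    ultimately show ?thesis by blast
  qed
  have "card ?S = card (A \<inter> {1..int R})"
    by (intro card_image) auto
  moreover have "(A \<inter> {1..int (R * k)}) \<inter> ?S = {}" by auto
  ultimately show ?case
    unfolding split using Suc by (subst card_Un_disjoint) auto
qed

lemma upper_density_periodic:
  fixes R :: nat
  assumes R: "R > 0" and per: "\<And>x. x + int R \<in> A \<longleftrightarrow> x \<in> A"
  shows "upper_density A = ereal (real (card (A \<inter> {1..int R})) / real R)"
proof (rule antisym)
  let ?c = "card (A \<inter> {1..int R})"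
  show "upper_density A \<le> ereal (real ?c / real R)"
  proof (rule upper_density_le_of_linear_bound)
    fix N :: nat
    have "N \<le> R * (N div R + 1)"
    proof -
      have "N = R * (N div R) + N mod R" "N mod R < R" using R by simp_all
      then show ?thesis unfolding distrib_left mult_1_right by linarith
    qed
    then have "A \<inter> {1..int N} \<subseteq> A \<inter> {1..int (R * (N div R + 1))}"
      by (auto simp del: of_nat_mult)
    then have "card (A \<inter> {1..int N}) \<le> card (A \<inter> {1..int (R * (N div R + 1))})"
      by (intro card_mono) auto
    also have "\<dots> = (N div R + 1) * ?c" by (rule card_periodic_initial[OF per])
    finally have "real (card (A \<inter> {1..int N})) \<le> real ((N div R + 1) * ?c)"
      by (simp only: of_nat_le_iff)
    also have "\<dots> = (real (N div R) + 1) * real ?c" by (simp only: of_nat_mult of_nat_add of_nat_1)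
    also have "\<dots> \<le> (real N / real R + 1) * real ?c"
      by (intro mult_right_mono add_right_mono of_nat_div_le_of_nat) auto
    finally show "real (card (A \<inter> {1..int N})) \<le> real ?c / real R * real N + real ?c"
      by (simp add: algebra_simps)
  qed
  let ?u = "\<lambda>N::nat. ereal (real (card (A \<inter> {1..int N})) / real N)"
  have "ereal (real ?c / real R) = limsup (\<lambda>k::nat. ereal (real ?c / real R))"
    by (simp add: Limsup_const)
  also have "\<dots> = limsup (?u \<circ> (\<lambda>k. R * Suc k))"
  proof -
    have "?u (R * Suc k) = ereal (real ?c / real R)" for k
      using R unfolding card_periodic_initial[OF per] of_nat_mult[where 'a = real]
      by (simp del: of_nat_Suc mult_Suc)
    then have "(?u \<circ> (\<lambda>k. R * Suc k)) = (\<lambda>k. ereal (real ?c / real R))"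
      by (simp only: o_def)
    then show ?thesis by simp
  qed
  also have "\<dots> \<le> limsup ?u"
    using R by (intro limsup_subseq_mono) (auto simp: strict_mono_def)
  finally show "ereal (real ?c / real R) \<le> upper_density A"
    by (simp add: upper_density_def)
qed

lemma card_affine_period:
  fixes q s :: int and R :: nat
  assumes R: "R > 0" and per: "\<And>x. x + int R \<in> A \<longleftrightarrow> x \<in> A" and cop: "coprime q (int R)"
  shows "card ({t. q * t + s \<in> A} \<inter> {1..int R}) = card (A \<inter> {0..<int R})"
proof (rule bij_betw_same_card)
  let ?f = "\<lambda>t. (q * t + s) mod int R"
  have inj: "inj_on ?f {1..int R}"
  proof
    fix t u assume tu: "t \<in> {1..int R}" "u \<in> {1..int R}" "?f t = ?f u"
    then have "[q * t + s = q * u + s] (mod int R)"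
      by (simp add: cong_def)
    then have "[t = u] (mod int R)"
      using cop by (simp only: cong_add_rcancel cong_mult_lcancel)
    then have "[t - 1 = u - 1] (mod int R)" by (simp add: cong_diff)
    then have "t - 1 = u - 1" using tu by (intro cong_less_imp_eq_int) auto
    then show "t = u" by simp
  qed
  have image: "?f ` {1..int R} = {0..<int R}"
    using R by (intro card_subset_eq) (auto simp: card_image[OF inj])
  have mod: "?f t \<in> A \<longleftrightarrow> q * t + s \<in> A" for t
    using periodic_add_mult[of "int R" A "?f t" "(q * t + s) div int R", OF per] by simp
  have "?f ` ({t. q * t + s \<in> A} \<inter> {1..int R}) = A \<inter> {0..<int R}"
  proof (intro equalityI subsetI)
    fix z assume z: "z \<in> A \<inter> {0..<int R}"
    then obtain t where "t \<in> {1..int R}" "z = ?f t" using image by blast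
    with z mod[of t] show "z \<in> ?f ` ({t. q * t + s \<in> A} \<inter> {1..int R})" by blast
  qed (use R mod in auto)
  then show "bij_betw ?f ({t. q * t + s \<in> A} \<inter> {1..int R}) (A \<inter> {0..<int R})"
    using inj by (auto simp: bij_betw_def inj_on_def)
qed

text \<open>No factor \<open>q\<close> is lost when the period is coprime to \<open>q\<close>: by the Chinese remainder theorem the
  progression then meets all residue classes modulo the period equally often.\<close>
lemma upper_density_affine_preimage_periodic:
  fixes q s :: int and R :: nat
  assumes R: "R > 0" and per: "\<And>x. x + int R \<in> A \<longleftrightarrow> x \<in> A" and cop: "coprime q (int R)"
  shows "upper_density {t. q * t + s \<in> A} = upper_density A"
proof -
  have per': "t + int R \<in> {t. q * t + s \<in> A} \<longleftrightarrow> t \<in> {t. q * t + s \<in> A}" for t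
    using periodic_add_mult[of "int R" A "q * t + s" q, OF per] by (simp add: algebra_simps)
  have "card ({t. q * t + s \<in> A} \<inter> {1..int R}) = card (A \<inter> {1..int R})"
    using card_affine_period[OF R per cop, of s] card_affine_period[OF R per, of 1 0] by simp
  then show ?thesis
    by (simp add: upper_density_periodic[OF R per] upper_density_periodic[OF R per'])
qed

section \<open>Multiples and light tails\<close>

definition tail_multiples :: "nat set \<Rightarrow> nat \<Rightarrow> int set" where
  "tail_multiples B K = (\<Union>b\<in>{b \<in> B. b > K}. multiples b)"

lemma mem_multiples_iff: "x \<in> multiples b \<longleftrightarrow> int b dvd x"
  by (auto simp: multiples_def dvd_def)

lemma mem_free_set_iff: "x \<in> free_set B \<longleftrightarrow> (\<forall>b\<in>B. \<not> int b dvd x)"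
  by (auto simp: free_set_def mem_multiples_iff)

lemma light_tails_obtain:
  assumes "light_tails B" "e > 0"
  obtains K where "upper_density (tail_multiples B K) \<le> ereal e"
proof -
  have "eventually (\<lambda>K. upper_density (tail_multiples B K) < ereal e) sequentially"
    using assms unfolding light_tails_def tail_multiples_def
    by (intro order_tendstoD(2)) auto
  then obtain K where "upper_density (tail_multiples B K) < ereal e"
    by (auto simp: eventually_sequentially)
  then show ?thesis by (intro that[of K] less_imp_le)
qed

text \<open>The density estimate behind the whole argument. The multiples of the cofactors \<open>c\<close> form a
  periodic set whose period is coprime to \<open>Q\<close>, so the bound does not depend on \<open>Q\<close>; and
  multiplication by \<open>d\<close> maps this set into the multiples of the elements \<open>d * c > y\<close> of \<open>B\<close>,
  at the cost of the factor \<open>d\<close> only.\<close>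
lemma upper_density_cofactor_multiples_le:
  fixes Q s :: int and d :: nat
  assumes tail: "upper_density (tail_multiples B y) \<le> ereal r"
    and d: "d > 0" and T: "finite T" "0 \<notin> T" "\<And>c. c \<in> T \<Longrightarrow> d * c \<in> B \<and> y < d * c"
    and cop: "\<And>c. c \<in> T \<Longrightarrow> coprime (int c) Q"
  shows "upper_density {t. Q * t + s \<in> (\<Union>c\<in>T. multiples c)} \<le> ereal (real d * r)"
proof -
  let ?M = "\<Union>c\<in>T. multiples c" and ?R = "\<Prod>T"
  have R: "?R > 0" using T by (intro prod_pos) (metis gr0I)
  have dvd: "int c dvd int ?R" if "c \<in> T" for c
    using dvd_prodI[OF T(1) that, of "\<lambda>x. x"] by (simp del: of_nat_prod)
  have per: "x + int ?R \<in> ?M \<longleftrightarrow> x \<in> ?M" for x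
    using dvd by (auto simp: mem_multiples_iff dvd_add_left_iff simp del: of_nat_prod)
  have "coprime Q (int ?R)"
    using cop by (auto simp: coprime_commute intro!: prod_coprime_right)
  then have "upper_density {t. Q * t + s \<in> ?M} = upper_density ?M"
    by (rule upper_density_affine_preimage_periodic[OF R per])
  also have "\<dots> \<le> upper_density {t. int d * t + 0 \<in> tail_multiples B y}"
  proof (rule upper_density_mono, rule subsetI)
    fix x assume "x \<in> ?M"
    then obtain c where c: "c \<in> T" "int c dvd x" by (auto simp: mem_multiples_iff)
    then have "int (d * c) dvd int d * x" by simp
    then show "x \<in> {t. int d * t + 0 \<in> tail_multiples B y}"
      using T(3)[OF c(1)] by (auto simp: tail_multiples_def mem_multiples_iff simp del: of_nat_mult)
  qed
  also have "\<dots> \<le> ereal (real_of_int (int d) * r)"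
    using d by (intro upper_density_affine_preimage_le[OF _ tail]) auto
  finally show ?thesis by simp
qed

section \<open>New divisors of a perturbed integer\<close>

text \<open>Write \<open>x = n * u\<close>. The square in the modulus makes \<open>u\<close> congruent to 1 modulo a number with the
  same prime factors as the modulus, so \<open>u\<close> is coprime to the modulus. The part of \<open>b\<close> that does not
  come from \<open>n\<close> divides \<open>u\<close>; it is nontrivial because \<open>b\<close> does not divide \<open>n\<close>, and being coprime to
  \<open>y!\<close> it must exceed \<open>y\<close>. The factor \<open>F\<close> leaves room for further prime factors that the new part
  has to avoid.\<close>
lemma new_divisor_split:
  fixes n P F x :: int and b y :: nat
  assumes n: "n \<noteq> 0" "n dvd P" and x: "[x = n] (mod P\<^sup>2 * fact y * F)"
    and b: "b > 0" "int b dvd x" "\<not> int b dvd n"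
  obtains d c where "b = d * c" "int d dvd n" "int c dvd x" "y < c"
    "coprime (int c) (P\<^sup>2 * fact y * F)"
proof -
  let ?L = "P\<^sup>2 * fact y * F"
  obtain P' where P': "P = n * P'" using n by auto
  obtain k where k: "x = n + ?L * k" using x
    by (metis cong_iff_lin cong_sym)
  define v where "v = P' * P * fact y * F"
  have L: "?L = n * v" by (simp add: v_def P' power2_eq_square)
  define u where "u = 1 + v * k"
  have x_eq: "x = n * u" unfolding k L u_def by (simp add: algebra_simps)
  have uv: "coprime u v"
    unfolding u_def by (metis coprime_1_left coprime_iff_gcd_eq_1 gcd_add_mult gcd.commute add.commute mult.commute)
  have "?L dvd v\<^sup>2"
    unfolding v_def by (auto simp: power_mult_distrib power2_eq_square intro!: mult_dvd_mono)
  with uv have uL: "coprime u ?L"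
    by (meson coprime_divisors coprime_power_right_iff dvd_refl)
  define d where "d = nat (gcd (int b) n)"
  have int_d: "int d = gcd (int b) n" by (simp add: d_def)
  define c where "c = b div d"
  have "int d dvd int b" "int d dvd n" "int d \<noteq> 0" unfolding int_d using b by auto
  then have d: "d > 0" "d dvd b" "int d dvd n" by auto
  have bdc: "b = d * c" using d by (simp add: c_def)
  have cop: "coprime (int c) (n div int d)" unfolding c_def zdiv_int int_d using b
    by (intro div_gcd_coprime) auto
  have "int d * int c dvd int d * ((n div int d) * u)"
    using b(2) bdc d(3) by (simp add: x_eq flip: mult.assoc)
  then have "int c dvd (n div int d) * u" using d(1) by simp
  with cop have cu: "int c dvd u" by (simp add: coprime_dvd_mult_right_iff)
  with uL have cL: "coprime (int c) ?L" by (meson coprime_divisors dvd_refl)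
  have "c \<noteq> 1" using b(3) d(3) bdc by auto
  moreover have "c > 0" using b(1) bdc by (simp add: gr0I)
  moreover have "c dvd fact y \<Longrightarrow> c = 1"
  proof -
    assume "c dvd fact y"
    then have "int c dvd fact y" by (metis of_nat_dvd_iff of_nat_fact)
    then have "int c dvd ?L" by simp
    then have "is_unit (int c)" by (rule coprime_common_divisor[OF cL dvd_refl])
    then show "c = 1" by simp
  qed
  ultimately have "\<not> c \<le> y" using dvd_fact[of c y] by auto
  then have "y < c" by simp
  moreover have "int c dvd x" using cu by (simp add: x_eq)
  ultimately show ?thesis using that[OF bdc d(3) _ _ cL] by blast
qed

section \<open>Realising a prescribed pattern\<close>

text \<open>Only finitely many members of a pairwise coprime family can share a factor with \<open>L\<close>, since their
  greatest common divisors with \<open>L\<close> are distinct divisors of \<open>L\<close>.\<close>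
lemma infinite_coprime_choice:
  fixes A :: "nat set" and L :: int
  assumes A: "infinite A" "pairwise coprime A" and L: "L \<noteq> 0" and C: "finite C"
  obtains a where "\<And>j. j \<in> C \<Longrightarrow> a j \<in> A" "\<And>j. j \<in> C \<Longrightarrow> coprime (int (a j)) L"
    "\<And>j k. j \<in> C \<Longrightarrow> k \<in> C \<Longrightarrow> j \<noteq> k \<Longrightarrow> coprime (a j) (a k)"
proof -
  let ?N = "{a \<in> A. \<not> coprime (int a) L}" and ?g = "\<lambda>a. gcd (int a) L"
  have "inj_on ?g ?N"
  proof (rule inj_onI, rule ccontr)
    fix a a' assume *: "a \<in> ?N" "a' \<in> ?N" "?g a = ?g a'" "a \<noteq> a'"
    then have "coprime a a'" using A(2) by (auto simp: pairwise_def)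
    then have "coprime (int a) (int a')" by simp
    moreover have "?g a dvd int a" "?g a dvd int a'" by (simp, metis *(3) gcd_dvd1)
    ultimately have "is_unit (?g a)" using coprime_common_divisor by blast
    then show False using *(1) by (simp add: coprime_iff_gcd_eq_1)
  qed
  moreover have "finite (?g ` ?N)"
    by (rule finite_subset[of _ "{g. g dvd L}"]) (use L in auto)
  ultimately have "finite ?N" using finite_image_iff by blast
  then have "infinite (A - ?N)" using A(1) by simp
  then obtain D where D: "D \<subseteq> A - ?N" "finite D" "card D = card C"
    using infinite_arbitrarily_large by blast
  then obtain a where "bij_betw a C D"
    using finite_same_card_bij[OF C D(2)] by metis
  then have a: "a ` C \<subseteq> A - ?N" "inj_on a C" using D by (auto simp: bij_betw_def)
  show ?thesis
  proof
    show "coprime (a j) (a k)" if "j \<in> C" "k \<in> C" "j \<noteq> k" for j k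
      using that a by (intro pairwiseD[OF A(2)]) (auto dest: inj_onD)
  qed (use a in auto)
qed

lemma chinese_remainder_int_family:
  fixes L m :: int and a u :: "'a \<Rightarrow> int"
  assumes "finite C" and "\<And>j. j \<in> C \<Longrightarrow> coprime (a j) L"
    and "\<And>j k. j \<in> C \<Longrightarrow> k \<in> C \<Longrightarrow> j \<noteq> k \<Longrightarrow> coprime (a j) (a k)"
  shows "\<exists>x. [x = m] (mod L) \<and> (\<forall>j\<in>C. [x = u j] (mod a j))"
  using assms
proof (induction C rule: finite_induct)
  case empty
  show ?case by (auto intro: exI[of _ m])
next
  case (insert k C)
  then obtain x where x: "[x = m] (mod L)" "\<forall>j\<in>C. [x = u j] (mod a j)" by auto
  have "coprime (L * prod a C) (a k)"
  proof -
    have "coprime (prod a C) (a k)"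
      by (rule prod_coprime_left) (use insert.hyps(2) insert.prems(2) in auto)
    moreover have "coprime L (a k)" using insert.prems(1)[of k] by (simp add: coprime_commute)
    ultimately show ?thesis by simp
  qed
  then obtain z where z: "[z = x] (mod L * prod a C)" "[z = u k] (mod a k)"
    using binary_chinese_remainder_int by blast
  have "[z = x] (mod L)" using z(1) by (rule cong_dvd_modulus) simp
  moreover have "[z = x] (mod a j)" if "j \<in> C" for j
    using z(1) by (rule cong_dvd_modulus) (use that insert(1) in \<open>auto intro: dvd_mult dvd_prodI\<close>)
  ultimately show ?case using x z(2) by (auto intro: cong_trans)
qed

text \<open>The arithmetic core: every \<open>B\<close>-free position over \<open>I\<close> can be kept while every position in \<open>C\<close>
  is made divisible by an element of \<open>B\<close>. The order of the choices matters. The threshold \<open>y\<close>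
  depends only on the divisors of the numbers \<open>m + i\<close>; the modulus \<open>Q\<close> of the progression depends
  on \<open>y\<close>; the second threshold \<open>K\<close> depends on \<open>Q\<close>. Elements of \<open>B\<close> up to \<open>K\<close> are controlled
  by a bound that is independent of \<open>Q\<close>, and those beyond \<open>K\<close> by the cruder bound that has a factor
  \<open>Q\<close>.\<close>
lemma exists_translate_with_pattern:
  fixes B :: "nat set" and I C :: "int set" and m :: int
  assumes B: "0 \<notin> B" "light_tails B"
    and A: "A \<subseteq> B" "infinite A" "pairwise coprime A"
    and fin: "finite I" "finite C" "I \<inter> C = {}"
    and free: "\<And>i. i \<in> I \<Longrightarrow> m + i \<in> free_set B"
  obtains x where "\<And>i. i \<in> I \<Longrightarrow> x + i \<in> free_set B" "\<And>j. j \<in> C \<Longrightarrow> x + j \<notin> free_set B"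
proof -
  let ?n = "\<lambda>i. m + i" and ?D = "\<lambda>i. {d::nat. int d dvd m + i}"
  \<comment> \<open>\<open>F\<close> keeps new divisors at positions in \<open>I\<close> coprime to the elements of \<open>A\<close> used at positions in
    \<open>C\<close>; \<open>S\<close> is the total loss of density in the divisor estimates.\<close>
  define P where "P = (\<Prod>i\<in>I. ?n i)"
  define F where "F = (\<Prod>i\<in>I. \<Prod>j\<in>C. i - j)"
  define S where "S = (\<Sum>i\<in>I. \<Sum>d\<in>?D i. real d)"
  have n0: "?n i \<noteq> 0" if "i \<in> I" for i
  proof
    assume "?n i = 0"
    moreover obtain b where "b \<in> B" using A(1,2) by (metis finite.emptyI subset_empty subsetI)
    ultimately show False using free[OF that] by (auto simp: mem_free_set_iff)
  qed
  have finD: "finite (?D i)" if "i \<in> I" for i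
  proof (rule finite_subset)
    show "?D i \<subseteq> nat ` {g. g dvd ?n i}" by (auto simp: image_iff intro!: exI[of _ "int _"])
  qed (use n0[OF that] in simp)
  have S: "S \<ge> 0" unfolding S_def by (intro sum_nonneg) auto
  have "0 < 1 / (3 * (S + 1))" using S by simp
  from light_tails_obtain[OF B(2) this]
  obtain y where y: "upper_density (tail_multiples B y) \<le> ereal (1 / (3 * (S + 1)))" .
  define L where "L = P\<^sup>2 * fact y * F"
  have L0: "L \<noteq> 0" using n0 fin by (auto simp: L_def P_def F_def)
  obtain a where a: "\<And>j. j \<in> C \<Longrightarrow> a j \<in> A" "\<And>j. j \<in> C \<Longrightarrow> coprime (int (a j)) L"
    "\<And>j k. j \<in> C \<Longrightarrow> k \<in> C \<Longrightarrow> j \<noteq> k \<Longrightarrow> coprime (a j) (a k)"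
    using infinite_coprime_choice[OF A(2,3) L0 fin(2)] by metis
  have "\<exists>x. [x = m] (mod L) \<and> (\<forall>j\<in>C. [x = - j] (mod int (a j)))"
    using a by (intro chinese_remainder_int_family[OF fin(2)]) auto
  then obtain x0 where x0: "[x0 = m] (mod L)" "\<And>j. j \<in> C \<Longrightarrow> int (a j) dvd x0 + j"
    by (auto simp: cong_iff_dvd_diff)
  define Q where "Q = \<bar>L\<bar> * (\<Prod>j\<in>C. int (a j))"
  have Q: "Q > 0"
  proof -
    have "a j > 0" if "j \<in> C" for j
      using a(1)[OF that] A(1) B(1) by (metis gr0I subsetD)
    then show ?thesis using L0 by (simp add: Q_def prod_pos)
  qed
  have LQ: "L dvd Q" by (simp add: Q_def)
  have aQ: "int (a j) dvd Q" if "j \<in> C" for j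
    using that fin unfolding Q_def by (intro dvd_mult dvd_prodI)
  have "0 < 1 / (3 * (real (card I) + 1) * real_of_int Q)" using Q by simp
  from light_tails_obtain[OF B(2) this]
  obtain K where K: "upper_density (tail_multiples B K) \<le> ereal (1 / (3 * (real (card I) + 1) * real_of_int Q))" .
  \<comment> \<open>Bounding \<open>d * c\<close> by \<open>K\<close> makes \<open>T d\<close> finite, hence its set of multiples periodic.\<close>
  define T where "T d = {c. d * c \<in> B \<and> y < d * c \<and> d * c \<le> K \<and> coprime (int c) Q}" for d
  let ?small = "\<lambda>i. \<Union>d\<in>?D i. {t. Q * t + (x0 + i) \<in> (\<Union>c\<in>T d. multiples c)}"
  let ?large = "\<lambda>i. {t. Q * t + (x0 + i) \<in> tail_multiples B K}"
  let ?bad = "\<Union>i\<in>I. ?small i \<union> ?large i"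

  have bad: "t \<in> ?bad" if t: "i \<in> I" "Q * t + x0 + i \<notin> free_set B" for i t
  proof -
    let ?x = "Q * t + x0 + i"
    obtain b where b: "b \<in> B" "int b dvd ?x" using t by (auto simp: mem_free_set_iff)
    have b0: "b > 0" using b B by (auto intro: gr0I)
    show ?thesis
    proof (cases "b > K")
      case True
      with b t(1) show ?thesis by (auto simp: tail_multiples_def mem_multiples_iff algebra_simps)
    next
      case False
      have "[Q * t + x0 + i = 0 + m + i] (mod L)"
        using LQ by (intro cong_add x0 cong_refl) (simp add: cong_0_iff)
      then have x: "[?x = ?n i] (mod P\<^sup>2 * fact y * F)" by (simp add: L_def)
      have "?n i dvd P" using t fin by (auto simp: P_def intro: dvd_prodI)
      moreover have "\<not> int b dvd ?n i" using free[OF t(1)] b by (auto simp: mem_free_set_iff)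
      ultimately obtain d c where dc: "b = d * c" "int d dvd ?n i" "int c dvd ?x" "y < c"
        "coprime (int c) L"
        using new_divisor_split[OF n0[OF t(1)] _ x b0 b(2)] unfolding L_def by metis
      \<comment> \<open>A common divisor of \<open>c\<close> and \<open>a j\<close> divides the distance of the positions \<open>i\<close> and \<open>j\<close>, hence \<open>L\<close>,
        to which \<open>a j\<close> is coprime.\<close>
      have "coprime (int c) (int (a j))" if j: "j \<in> C" for j
      proof (rule coprimeI)
        fix z assume z: "z dvd int c" "z dvd int (a j)"
        have "z dvd ?x" using z(1) dc(3) by (rule dvd_trans)
        moreover have "z dvd Q * t + (x0 + j)"
          using z(2) aQ[OF j] x0(2)[OF j] by (meson dvd_add dvd_mult2 dvd_trans)
        ultimately have "z dvd ?x - (Q * t + (x0 + j))" by (rule dvd_diff)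
        then have "z dvd i - j" by simp
        moreover have "i - j dvd F" unfolding F_def
          using fin t(1) j by (meson dvd_prodI dvd_trans)
        ultimately have "z dvd L" unfolding L_def by (meson dvd_mult dvd_trans)
        with z(2) a(2)[OF j] show "is_unit z" using coprime_common_divisor by blast
      qed
      then have "coprime (int c) Q"
        unfolding Q_def using dc(5) by (auto intro: prod_coprime_right)
      moreover have "y < d * c" using dc(1,4) b0 by (cases d) auto
      ultimately have "c \<in> T d" using dc b False by (auto simp: T_def)
      with dc t(1) show ?thesis
        by (auto simp: mem_multiples_iff algebra_simps)
    qed
  qed

  have small: "upper_density (?small i) \<le> ereal (\<Sum>d\<in>?D i. real d * (1 / (3 * (S + 1))))"
    if "i \<in> I" for i
  proof (rule upper_density_UN_le[OF finD[OF that]])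
    fix d assume "d \<in> ?D i"
    then have d: "d > 0" using n0[OF that] by (auto intro: gr0I)
    have "T d \<subseteq> {..K}"
    proof
      fix c assume "c \<in> T d"
      then have "d * c \<le> K" by (simp add: T_def)
      moreover have "1 * c \<le> d * c" using d by (intro mult_right_mono) auto
      ultimately show "c \<in> {..K}" unfolding atMost_iff by linarith
    qed
    then have "finite (T d)" using finite_subset by blast
    then show "upper_density {t. Q * t + (x0 + i) \<in> (\<Union>c\<in>T d. multiples c)}
        \<le> ereal (real d * (1 / (3 * (S + 1))))"
      by (rule upper_density_cofactor_multiples_le[OF y d]) (auto simp: T_def)
  qed
  have large: "upper_density (?large i) \<le> ereal (real_of_int Q * (1 / (3 * (real (card I) + 1) * real_of_int Q)))" for i
    by (rule upper_density_affine_preimage_le[OF Q K])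
  have "upper_density ?bad \<le> ereal (\<Sum>i\<in>I. (\<Sum>d\<in>?D i. real d * (1 / (3 * (S + 1))))
      + real_of_int Q * (1 / (3 * (real (card I) + 1) * real_of_int Q)))"
    by (intro upper_density_UN_le fin upper_density_Un_le small large)
  also have "(\<Sum>i\<in>I. (\<Sum>d\<in>?D i. real d * (1 / (3 * (S + 1))))
      + real_of_int Q * (1 / (3 * (real (card I) + 1) * real_of_int Q)))
      = S / (3 * (S + 1)) + real (card I) / (3 * (real (card I) + 1))"
    using Q by (simp add: sum.distrib S_def sum_divide_distrib)
  also have "ereal \<dots> < 1"
  proof -
    have "S / (3 * (S + 1)) \<le> 1 / 3" "real (card I) / (3 * (real (card I) + 1)) \<le> 1 / 3"
      using S by (simp_all add: field_simps)
    then show ?thesis unfolding one_ereal_def less_ereal.simps by linarith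
  qed
  finally have "?bad \<noteq> UNIV" using upper_density_UNIV by force
  then obtain t where t: "t \<notin> ?bad" by blast
  show ?thesis
  proof
    show "Q * t + x0 + i \<in> free_set B" if "i \<in> I" for i
      using bad[OF that] t by blast
    show "Q * t + x0 + j \<notin> free_set B" if "j \<in> C" for j
    proof -
      have "int (a j) dvd Q * t + x0 + j"
        using aQ[OF that] x0(2)[OF that] by (simp add: add.assoc)
      then show ?thesis using a(1)[OF that] A(1) by (auto simp: mem_free_set_iff)
    qed
  qed
qed

section \<open>Heredity of the orbit closure\<close>

lemma mem_closure_iff_windows:
  fixes X :: "(int \<Rightarrow> bool) set"
  shows "x \<in> closure X \<longleftrightarrow> (\<forall>w. \<exists>z\<in>X. \<forall>i\<in>{-w..w}. z i = x i)"
proof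
  assume x: "x \<in> closure X"
  show "\<forall>w. \<exists>z\<in>X. \<forall>i\<in>{-w..w}. z i = x i"
  proof
    fix w :: int
    let ?U = "Pi\<^sub>E UNIV (\<lambda>i. if i \<in> {-w..w} then {x i} else UNIV)"
    have "open ?U"
    proof (rule open_PiE)
      show "finite {i. (if i \<in> {-w..w} then {x i} else UNIV) \<noteq> UNIV}"
        by (rule finite_subset[of _ "{-w..w}"]) auto
    qed (rule open_bool)
    moreover have "x \<in> ?U" by (auto simp: PiE_iff)
    ultimately obtain z where "z \<in> X" "z \<in> ?U"
      using x unfolding closure_iff_nhds_not_empty by blast
    then show "\<exists>z\<in>X. \<forall>i\<in>{-w..w}. z i = x i"
      by (intro bexI[of _ z]) (auto simp: PiE_iff split: if_splits)
  qed
next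
  assume R: "\<forall>w. \<exists>z\<in>X. \<forall>i\<in>{-w..w}. z i = x i"
  show "x \<in> closure X"
    unfolding closure_iff_nhds_not_empty
  proof (intro allI impI)
    fix V U :: "(int \<Rightarrow> bool) set" assume "U \<subseteq> V" "open U" "x \<in> U"
    then have "openin (product_topology (\<lambda>i. euclidean) UNIV) U" by (simp add: open_fun_def)
    from product_topology_open_contains_basis[OF this \<open>x \<in> U\<close>]
    obtain Y where Y: "x \<in> Pi\<^sub>E UNIV Y" "finite {i. Y i \<noteq> UNIV}" "Pi\<^sub>E UNIV Y \<subseteq> U" by auto
    from Y(2) obtain w where w: "{i. Y i \<noteq> UNIV} \<subseteq> {-w..w}"
    proof -
      from Y(2) obtain w where "abs ` {i. Y i \<noteq> UNIV} \<subseteq> {..w}"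
        unfolding finite_int_iff_bounded_le by blast
      then have "{i. Y i \<noteq> UNIV} \<subseteq> {-w..w}"
        by (auto simp: image_subset_iff abs_le_iff)
      then show ?thesis by (rule that)
    qed
    from R obtain z where z: "z \<in> X" "\<forall>i\<in>{-w..w}. z i = x i" by blast
    have "z i \<in> Y i" for i
    proof (cases "i \<in> {-w..w}")
      case True
      with z(2) Y(1) show ?thesis by (auto simp: PiE_iff)
    next
      case False
      with w have "Y i = UNIV" by blast
      then show ?thesis by simp
    qed
    then have "z \<in> U" using Y(3) by (auto simp: PiE_iff)
    with z(1) \<open>U \<subseteq> V\<close> show "X \<inter> V \<noteq> {}" by blast
  qed
qed

lemma mem_X_eta_iff:
  "x \<in> X_eta B \<longleftrightarrow> (\<forall>w. \<exists>m. \<forall>i\<in>{-w..w}. x i \<longleftrightarrow> m + i \<in> free_set B)"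
  unfolding X_eta_def mem_closure_iff_windows
  by (auto simp: shift_power_apply eta_def add.commute eq_commute)

text \<open>Translation by \<open>k\<close> moves a window by at most \<open>\<bar>k\<bar>\<close>, which an enlarged window absorbs.\<close>
lemma X_eta_translate:
  assumes "x \<in> X_eta B"
  shows "(\<lambda>n. x (n + k)) \<in> X_eta B"
  unfolding mem_X_eta_iff
proof
  fix w
  from assms obtain m where m: "\<forall>i\<in>{-(w + \<bar>k\<bar>)..w + \<bar>k\<bar>}. x i \<longleftrightarrow> m + i \<in> free_set B"
    unfolding mem_X_eta_iff by blast
  have "x (i + k) \<longleftrightarrow> (m + k) + i \<in> free_set B" if "i \<in> {-w..w}" for i
  proof -
    have "i + k \<in> {-(w + \<bar>k\<bar>)..w + \<bar>k\<bar>}" using that by auto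
    with m have "x (i + k) \<longleftrightarrow> m + (i + k) \<in> free_set B" by blast
    then show ?thesis by (simp add: algebra_simps)
  qed
  then show "\<exists>m. \<forall>i\<in>{-w..w}. x (i + k) \<longleftrightarrow> m + i \<in> free_set B" by blast
qed

lemma subshift_X_eta: "subshift (X_eta B)"
  unfolding subshift_def
proof
  show "closed (X_eta B)" by (simp add: X_eta_def)
  show "shift ` X_eta B = X_eta B"
  proof (intro equalityI subsetI)
    fix x assume "x \<in> X_eta B"
    then have "(\<lambda>n. x (n + (- 1))) \<in> X_eta B" by (rule X_eta_translate)
    moreover have "x = shift (\<lambda>n. x (n + (- 1)))" by (simp add: shift_def)
    ultimately show "x \<in> shift ` X_eta B" by blast
  qed (auto simp: shift_def intro: X_eta_translate)
qed

lemma hereditary_X_eta: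
  assumes B: "0 \<notin> B" "light_tails B" and A: "A \<subseteq> B" "infinite A" "pairwise coprime A"
  shows "hereditary (X_eta B)"
  unfolding hereditary_def
proof (intro ballI allI impI)
  fix x y assume x: "x \<in> X_eta B" and yx: "y \<le> x"
  show "y \<in> X_eta B"
    unfolding mem_X_eta_iff
  proof
    fix w
    from x obtain m where m: "\<forall>i\<in>{-w..w}. x i \<longleftrightarrow> m + i \<in> free_set B"
      unfolding mem_X_eta_iff by blast
    let ?I = "{i \<in> {-w..w}. y i}" and ?C = "{i \<in> {-w..w}. \<not> y i}"
    have fin: "finite ?I" "finite ?C" "?I \<inter> ?C = {}"
      by (auto intro: finite_subset[of _ "{-w..w}"])
    have free: "m + i \<in> free_set B" if "i \<in> ?I" for i
      using that m yx by (auto simp: le_fun_def)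
    obtain z where "\<And>i. i \<in> ?I \<Longrightarrow> z + i \<in> free_set B" "\<And>j. j \<in> ?C \<Longrightarrow> z + j \<notin> free_set B"
      using exists_translate_with_pattern[OF B A fin free] by blast
    then have "y i \<longleftrightarrow> z + i \<in> free_set B" if "i \<in> {-w..w}" for i
      using that by blast
    then show "\<exists>m. \<forall>i\<in>{-w..w}. y i \<longleftrightarrow> m + i \<in> free_set B" by blast
  qed
qed

theorem theorem4:
  fixes B :: "nat set"
  assumes "0 \<notin> B"
    and "light_tails B"
    and "\<exists>A. A \<subseteq> B \<and> infinite A \<and> pairwise coprime A"
  shows "X_eta B = X_tilde B"
proof
  show "X_eta B \<subseteq> X_tilde B" by (rule X_tilde_smallest(3))
  from assms(3) obtain A where "A \<subseteq> B" "infinite A" "pairwise coprime A" by blast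
  with assms(1,2) have "hereditary (X_eta B)" by (rule hereditary_X_eta)
  with subshift_X_eta show "X_tilde B \<subseteq> X_eta B" by (rule X_tilde_smallest(4)) simp
qed

end
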